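(* Let $m\in\mathbb Z$ and let $\mathcal U_m$ be the affine scheme over $\mathbb Z$ defined by $x^2+y^2+z^2-xyz=m$. Suppose $\mathcal U_m(A_{\mathbb Z})\neq\emptyset$, where $\mathcal U_m(A_{\mathbb Z})=\mathcal U_m(\mathbb R)\times\prod_{p \text{ prime}}\mathcal U_m(\mathbb Z_p)$. Then for any finite set $S$ of primes, the image of the natural (diagonal) map $\mathcal U_m(\mathbb Z)\to\prod_{p\notin S}\mathcal U_m(\mathbb Z_p)$ is not dense (for the product of the $p$-adic topologies). *)

theory Defs
  imports "HOL-Analysis.Analysis"
begin

text \<open>The ring of p-adic integers Z_p, realised as the inverse limit of the rings Z/p^n Z:
  an element is a compatible sequence of residues x n \<in> {0..<p^n}.\<close>

definition padic_ints :: "nat \<Rightarrow> (nat \<Rightarrow> int) set" where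
  "padic_ints p = {x. (\<forall>n. 0 \<le> x n \<and> x n < int p ^ n) \<and>
                       (\<forall>n. x (Suc n) mod int p ^ n = x n)}"

definition padic_of_int :: "nat \<Rightarrow> int \<Rightarrow> (nat \<Rightarrow> int)" where
  "padic_of_int p k = (\<lambda>n. k mod int p ^ n)"

definition padic_add :: "nat \<Rightarrow> (nat \<Rightarrow> int) \<Rightarrow> (nat \<Rightarrow> int) \<Rightarrow> (nat \<Rightarrow> int)" where
  "padic_add p x y = (\<lambda>n. (x n + y n) mod int p ^ n)"

definition padic_sub :: "nat \<Rightarrow> (nat \<Rightarrow> int) \<Rightarrow> (nat \<Rightarrow> int) \<Rightarrow> (nat \<Rightarrow> int)" where
  "padic_sub p x y = (\<lambda>n. (x n - y n) mod int p ^ n)"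

definition padic_mult :: "nat \<Rightarrow> (nat \<Rightarrow> int) \<Rightarrow> (nat \<Rightarrow> int) \<Rightarrow> (nat \<Rightarrow> int)" where
  "padic_mult p x y = (\<lambda>n. (x n * y n) mod int p ^ n)"

text \<open>The p-adic topology on Z_p: generated by the balls x + p^n Z_p,
  i.e. the sets of elements agreeing with a given one modulo p^n.\<close>

definition padic_topology :: "nat \<Rightarrow> (nat \<Rightarrow> int) topology" where
  "padic_topology p = topology_generated_by
     {{y \<in> padic_ints p. y n = x n} | x n. x \<in> padic_ints p}"

definition markoff_padic :: "nat \<Rightarrow> (nat \<Rightarrow> int) \<Rightarrow> (nat \<Rightarrow> int) \<Rightarrow> (nat \<Rightarrow> int) \<Rightarrow> (nat \<Rightarrow> int)" where
  "markoff_padic p x y z =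
     padic_sub p (padic_add p (padic_add p (padic_mult p x x) (padic_mult p y y)) (padic_mult p z z))
                 (padic_mult p (padic_mult p x y) z)"

definition Um_Zp :: "int \<Rightarrow> nat \<Rightarrow> ((nat \<Rightarrow> int) \<times> (nat \<Rightarrow> int) \<times> (nat \<Rightarrow> int)) set" where
  "Um_Zp m p = {(x, y, z). x \<in> padic_ints p \<and> y \<in> padic_ints p \<and> z \<in> padic_ints p \<and>
                            markoff_padic p x y z = padic_of_int p m}"

definition Um_Zp_topology :: "int \<Rightarrow> nat \<Rightarrow> ((nat \<Rightarrow> int) \<times> (nat \<Rightarrow> int) \<times> (nat \<Rightarrow> int)) topology" where
  "Um_Zp_topology m p = subtopology
     (prod_topology (padic_topology p) (prod_topology (padic_topology p) (padic_topology p)))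
     (Um_Zp m p)"

definition Um_Z :: "int \<Rightarrow> (int \<times> int \<times> int) set" where
  "Um_Z m = {(x, y, z). x^2 + y^2 + z^2 - x*y*z = m}"

definition Um_R :: "int \<Rightarrow> (real \<times> real \<times> real) set" where
  "Um_R m = {(x, y, z). x^2 + y^2 + z^2 - x*y*z = real_of_int m}"

definition diag_map :: "nat set \<Rightarrow> int \<times> int \<times> int \<Rightarrow>
    (nat \<Rightarrow> (nat \<Rightarrow> int) \<times> (nat \<Rightarrow> int) \<times> (nat \<Rightarrow> int))" where
  "diag_map P = (\<lambda>(x, y, z). restrict (\<lambda>p. (padic_of_int p x, padic_of_int p y, padic_of_int p z)) P)"

end

theory Submission
  imports Defs "HOL-Number_Theory.Cong"
begin

text \<open>
  Vieta involutions such as \<open>(x, y, z) \<mapsto> (x, y, x y - z)\<close> act on integral and on \<open>p\<close>-adic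
  points alike, and they strictly decrease the size of an integral point whose coordinates are all
  large compared with \<open>m\<close>. Hence a Vieta-invariant congruence condition that forces every nonzero
  coordinate to be large can only hold on orbits of points with a vanishing coordinate.

  If \<open>m \<noteq> 0\<close>, choose large primes \<open>p \<noteq> q\<close> outside \<open>S\<close> modulo which \<open>m\<close> is a square. An integral
  point close to \<open>(\<surd>m, 0, 0)\<close> at \<open>p\<close> and to \<open>(0, \<surd>m, 0)\<close> at \<open>q\<close> satisfies the invariant condition
  \<open>p | y, z\<close> and \<open>q | x, z\<close>, and no such point has a vanishing coordinate. If \<open>m = 0\<close>, choose
  \<open>p\<close> such that \<open>-1\<close> is a square \<open>r\<^sup>2\<close> in \<open>\<int>\<^sub>p\<close>: the origin is the only integral point divisible
  by \<open>p\<close>, but \<open>(0, p, p r)\<close> is a \<open>p\<close>-adic one.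
\<close>

section \<open>Vieta descent\<close>

text \<open>The quadratic \<open>t^2 - a*b*t + a^2 + b^2 - m\<close> has the roots \<open>c\<close>
  and \<open>a*b - c\<close>. If the second were at least \<open>c\<close>, both would be at least
  \<open>b\<close>, so the value at \<open>b\<close> would be nonnegative. This gives
  \<open>m \<le> a^2 + 2*b^2 - a*b^2 \<le> (3 - a)*b^2\<close>, too negative for
  \<open>a \<ge> |m| + 4\<close>.\<close>

lemma vieta_decreases_max:
  fixes a b c m :: int
  assumes eq: "a^2 + b^2 + c^2 - a*b*c = m"
    and large: "\<bar>m\<bar> + 4 \<le> a" and ab: "a \<le> b" and bc: "b \<le> c"
  shows "\<bar>a*b - c\<bar> < c"
proof (rule ccontr)
  assume "\<not> \<bar>a*b - c\<bar> < c"
  moreover have "a * b > 0" using large ab by (intro mult_pos_pos) auto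
  ultimately have "2 * c \<le> a * b" by linarith
  then have "0 \<le> (c - b) * (a*b - b - c)"
    using bc by (intro mult_nonneg_nonneg) auto
  moreover have "a^2 \<le> b^2" using large ab by (intro power_mono) auto
  ultimately have "m \<le> (3 - a) * b^2"
    using eq by (simp add: algebra_simps power2_eq_square)
  moreover have "1 \<le> b^2" using large ab by simp
  then have "(a - 3) * 1 \<le> (a - 3) * b^2"
    using large by (intro mult_left_mono) auto
  ultimately show False using large by (simp add: algebra_simps)
qed

lemma vieta_decreases_one:
  fixes a b c m :: int
  assumes eq: "a^2 + b^2 + c^2 - a*b*c = m"
    and "\<bar>m\<bar> + 4 \<le> a" "\<bar>m\<bar> + 4 \<le> b" "\<bar>m\<bar> + 4 \<le> c"
  shows "\<bar>a*b - c\<bar> < c \<or> \<bar>a*c - b\<bar> < b \<or> \<bar>b*c - a\<bar> < a"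
proof -
  have "\<bar>r * s - t\<bar> < t"
    if "r^2 + s^2 + t^2 - r * s * t = m" "\<bar>m\<bar> + 4 \<le> r" "\<bar>m\<bar> + 4 \<le> s" "r \<le> t" "s \<le> t" for r s t
    using vieta_decreases_max[of r s t m] vieta_decreases_max[of s r t m] that
    by (cases "r \<le> s") (auto simp: algebra_simps)
  moreover have "(a \<le> c \<and> b \<le> c) \<or> (a \<le> b \<and> c \<le> b) \<or> (b \<le> a \<and> c \<le> a)" by linarith
  ultimately show ?thesis
    using assms by (auto simp: algebra_simps)
qed

text \<open>Carries the descent for positive coordinates over to arbitrary signs: here
  \<open>x*y\<close> and \<open>z\<close> have the same sign.\<close>

lemma abs_vieta:
  fixes x y z :: int
  assumes "x * y * z > 0"
  shows "\<bar>x*y - z\<bar> = \<bar>\<bar>x\<bar>*\<bar>y\<bar> - \<bar>z\<bar>\<bar>"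
proof -
  have "(x * y > 0 \<and> z > 0) \<or> (x * y < 0 \<and> z < 0)"
    using assms by (simp add: zero_less_mult_iff)
  then show ?thesis by (auto simp flip: abs_mult)
qed

text \<open>Induction on \<open>|x| + |y| + |z|\<close>: while no coordinate vanishes,
  \<open>large\<close> makes one of the involutions shrink the sum, and \<open>V\<close> keeps the
  new point in \<open>P\<close>.\<close>

lemma vieta_descent:
  fixes P :: "int \<Rightarrow> int \<Rightarrow> int \<Rightarrow> bool" and m :: int
  assumes "P x y z"
    and eq: "\<And>x y z. P x y z \<Longrightarrow> x^2 + y^2 + z^2 - x*y*z = m"
    and large: "\<And>x y z t. P x y z \<Longrightarrow> t \<in> {x, y, z} \<Longrightarrow> t \<noteq> 0 \<Longrightarrow> \<bar>m\<bar> + 4 \<le> \<bar>t\<bar>"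
    and V: "\<And>x y z. P x y z \<Longrightarrow> P (y*z - x) y z"
      "\<And>x y z. P x y z \<Longrightarrow> P x (x*z - y) z"
      "\<And>x y z. P x y z \<Longrightarrow> P x y (x*y - z)"
  shows "\<exists>x y z. P x y z \<and> (x = 0 \<or> y = 0 \<or> z = 0)"
  using \<open>P x y z\<close>
proof (induction "nat (\<bar>x\<bar> + \<bar>y\<bar> + \<bar>z\<bar>)" arbitrary: x y z rule: less_induct)
  case less
  show ?case
  proof (cases "x = 0 \<or> y = 0 \<or> z = 0")
    case True
    then show ?thesis using less.prems by blast
  next
    case False
    have L: "\<bar>m\<bar> + 4 \<le> \<bar>x\<bar>" "\<bar>m\<bar> + 4 \<le> \<bar>y\<bar>" "\<bar>m\<bar> + 4 \<le> \<bar>z\<bar>"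
      using large[OF less.prems] False by auto
    \<comment> \<open>A nonpositive product would give
      \<open>m \<ge> x^2 \<ge> |x| > m\<close>.\<close>
    have "x * y * z > 0"
    proof (rule ccontr)
      assume "\<not> x * y * z > 0"
      moreover have "\<bar>x\<bar> * 1 \<le> \<bar>x\<bar> * \<bar>x\<bar>" using L by (intro mult_left_mono) auto
      then have "\<bar>x\<bar> \<le> x^2" by (simp add: power2_eq_square)
      moreover have "y^2 \<ge> 0" "z^2 \<ge> 0" by auto
      ultimately show False using eq[OF less.prems] L(1) by linarith
    qed
    then have pos: "x * y * z > 0" "x * z * y > 0" "y * z * x > 0"
      by (auto simp: algebra_simps)
    have "\<bar>x\<bar> * \<bar>y\<bar> * \<bar>z\<bar> = x * y * z"
      using pos(1) by (simp flip: abs_mult)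
    then have "\<bar>x\<bar>^2 + \<bar>y\<bar>^2 + \<bar>z\<bar>^2 - \<bar>x\<bar> * \<bar>y\<bar> * \<bar>z\<bar> = m"
      using eq[OF less.prems] by simp
    from vieta_decreases_one[OF this L]
    consider "\<bar>x*y - z\<bar> < \<bar>z\<bar>" | "\<bar>x*z - y\<bar> < \<bar>y\<bar>" | "\<bar>y*z - x\<bar> < \<bar>x\<bar>"
      using pos by (auto simp: abs_vieta)
    then show ?thesis
    proof cases
      case 1
      then show ?thesis by (intro less.hyps[OF _ V(3)[OF less.prems]]) auto
    next
      case 2
      then show ?thesis by (intro less.hyps[OF _ V(2)[OF less.prems]]) auto
    next
      case 3
      then show ?thesis by (intro less.hyps[OF _ V(1)[OF less.prems]]) auto
    qed
  qed
qed

section \<open>Integral points under divisibility conditions\<close>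

lemma dvd_large:
  fixes m t :: int
  assumes "int p dvd t" "t \<noteq> 0" "nat \<bar>m\<bar> + 4 < p"
  shows "\<bar>m\<bar> + 4 \<le> \<bar>t\<bar>"
  using dvd_imp_le_int[OF assms(2,1)] assms(3) by linarith

text \<open>Handles the equation left over when one coordinate vanishes: a nonzero term would have a
  square exceeding \<open>m\<close>.\<close>

lemma sum_two_squares_large:
  fixes s t m :: int
  assumes "s^2 + t^2 = m" and "s \<noteq> 0 \<Longrightarrow> \<bar>m\<bar> + 4 \<le> \<bar>s\<bar>" and "t \<noteq> 0 \<Longrightarrow> \<bar>m\<bar> + 4 \<le> \<bar>t\<bar>"
  shows "s = 0 \<and> t = 0"
proof -
  have aux: "u = 0" if "u^2 + v^2 = m" "u \<noteq> 0 \<Longrightarrow> \<bar>m\<bar> + 4 \<le> \<bar>u\<bar>" for u v :: int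
  proof (rule ccontr)
    assume "u \<noteq> 0"
    then have "\<bar>m\<bar> + 4 \<le> \<bar>u\<bar>" using that by simp
    moreover have "\<bar>u\<bar> * 1 \<le> \<bar>u\<bar> * \<bar>u\<bar>" using \<open>u \<noteq> 0\<close> by (intro mult_left_mono) auto
    then have "\<bar>u\<bar> \<le> u^2" by (simp add: power2_eq_square)
    moreover have "v^2 \<ge> 0" by simp
    ultimately show False using that(1) by linarith
  qed
  show ?thesis using aux[of s t] aux[of t s] assms by (auto simp: add.commute)
qed

text \<open>Every coordinate is divisible by \<open>p\<close> or \<open>q\<close>, hence zero or
  large, and the involutions preserve all four divisibilities. The descent ends with
  \<open>m\<close> as a sum of two squares of such integers, which forces
  \<open>m = 0\<close>.\<close>

lemma no_integral_point_near_axes: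
  fixes m :: int
  assumes "m \<noteq> 0" and p: "nat \<bar>m\<bar> + 4 < p" and q: "nat \<bar>m\<bar> + 4 < q"
    and eq: "x^2 + y^2 + z^2 - x*y*z = m"
    and dvd: "int p dvd y" "int p dvd z" "int q dvd x" "int q dvd z"
  shows False
proof -
  define P where "P = (\<lambda>x y z. x^2 + y^2 + z^2 - x*y*z = m \<and>
    int p dvd y \<and> int p dvd z \<and> int q dvd x \<and> int q dvd z)"
  have large: "\<bar>m\<bar> + 4 \<le> \<bar>t\<bar>" if "P x y z" "t \<in> {x, y, z}" "t \<noteq> 0" for x y z t
    using that dvd_large[OF _ _ p, of t] dvd_large[OF _ _ q, of t] by (auto simp: P_def)
  have "\<exists>x y z. P x y z \<and> (x = 0 \<or> y = 0 \<or> z = 0)"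
  proof (rule vieta_descent[of P x y z m])
    show "P x y z" using eq dvd by (simp add: P_def)
  qed (use large in \<open>auto simp: P_def algebra_simps power2_eq_square\<close>)
  then obtain x y z where P: "P x y z" and "x = 0 \<or> y = 0 \<or> z = 0" by blast
  then consider "x = 0" "y^2 + z^2 = m" | "y = 0" "x^2 + z^2 = m" | "z = 0" "x^2 + y^2 = m"
    by (auto simp: P_def)
  then show False
    using sum_two_squares_large[of y z m] sum_two_squares_large[of x z m]
      sum_two_squares_large[of x y m] large[OF P] \<open>m \<noteq> 0\<close> by cases auto
qed

text \<open>Descent among the nonzero points, which the involutions permute since they fix the
  origin. Once a coordinate vanishes, two squares sum to 0, and the point is the origin after
  all.\<close>

lemma markoff_point_divisible_imp_zero:
  fixes x y z :: int
  assumes p: "4 < p" and eq: "x^2 + y^2 + z^2 - x*y*z = 0"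
    and dvd: "int p dvd x" "int p dvd y" "int p dvd z"
  shows "x = 0 \<and> y = 0 \<and> z = 0"
proof (rule ccontr)
  assume nz: "\<not> ?thesis"
  define P where "P = (\<lambda>x y z. x^2 + y^2 + z^2 - x*y*z = 0 \<and>
    int p dvd x \<and> int p dvd y \<and> int p dvd z \<and> \<not> (x = 0 \<and> y = 0 \<and> z = 0))"
  have large: "\<bar>0\<bar> + 4 \<le> \<bar>t\<bar>" if "P x y z" "t \<in> {x, y, z}" "t \<noteq> 0" for x y z t :: int
    using that dvd_large[of p t 0] p by (auto simp: P_def)
  have "\<exists>x y z. P x y z \<and> (x = 0 \<or> y = 0 \<or> z = 0)"
  proof (rule vieta_descent[of P x y z 0])
    show "P x y z" using eq dvd nz by (simp add: P_def)
  qed (use large in \<open>auto simp: P_def algebra_simps power2_eq_square\<close>)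
  then show False
    by (auto simp: P_def sum_power2_eq_zero_iff)
qed

section \<open>Square roots in the p-adic integers\<close>

text \<open>Euclid's argument: a prime factor of \<open>w = 4*k*(fact N)^2 - 1\<close> cannot divide
  \<open>fact N\<close>, so it exceeds \<open>N\<close>, and
  \<open>(2*k*fact N)^2 - k = k*w\<close>.\<close>

lemma ex_large_prime_dvd_square_diff:
  fixes k :: int
  assumes "k \<noteq> 0"
  obtains p n where "prime p" "N < p" "int p dvd n^2 - k"
proof -
  define F :: int where "F = (fact N)^2"
  define w where "w = 4 * (k * F) - 1"
  have "k * F \<noteq> 0" using assms by (simp add: F_def)
  \<comment> \<open>\<open>w = -1\<close> would need \<open>k*F = 0\<close>, and
    \<open>w = 1\<close> would need \<open>4*(k*F) = 2\<close>.\<close>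
  then have "nat \<bar>w\<bar> \<noteq> 1" unfolding w_def by linarith
  then obtain p where p: "prime p" "p dvd nat \<bar>w\<bar>" using prime_factor_nat by blast
  then have pw: "int p dvd w" by (simp add: int_dvd_int_iff[symmetric])
  have "N < p"
  proof (rule ccontr)
    assume "\<not> N < p"
    then have "p dvd fact N" using p(1) by (simp add: prime_dvd_fact_iff)
    then have "int p dvd fact N" by (metis of_nat_dvd_iff of_nat_fact)
    then have "int p dvd 4 * (k * F)" by (simp add: F_def power2_eq_square)
    then have "int p dvd 4 * (k * F) - w" using pw by (rule dvd_diff)
    then show False using p(1) by (simp add: w_def)
  qed
  moreover have "int p dvd (2 * k * fact N)^2 - k"
  proof -
    have "(2 * k * fact N)^2 - k = k * w"
      by (simp add: w_def F_def algebra_simps power2_eq_square)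
    then show ?thesis using pw by simp
  qed
  ultimately show thesis using that p(1) by blast
qed

text \<open>One Newton step: with \<open>a^2 - k = P*c\<close> and \<open>s\<close> inverse to
  \<open>2*a\<close> modulo \<open>p\<close>, the correction \<open>- P*c*s\<close> cancels the
  linear error modulo \<open>P*p\<close>; the quadratic error is a multiple of \<open>P*P\<close>,
  hence of \<open>P*p\<close>.\<close>

lemma square_root_lift:
  fixes a k P :: int
  assumes p: "prime p" "2 < p" and "\<not> int p dvd a" and "P dvd a^2 - k" and "int p dvd P"
  shows "\<exists>b. P * int p dvd b^2 - k \<and> [b = a] (mod P)"
proof -
  obtain c where c: "a^2 - k = P * c" using assms(4) by blast
  obtain d where d: "P = int p * d" using assms(5) by blast
  have "\<not> int p dvd 2"
    using p by (auto dest: zdvd_imp_le)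
  then have "\<not> int p dvd 2 * a"
    using assms(3) p(1) by (simp add: prime_dvd_mult_iff)
  then have "coprime (2 * a) (int p)"
    using p(1) by (metis coprime_commute prime_imp_coprime prime_nat_int_transfer)
  then obtain s where s: "[2 * a * s = 1] (mod int p)" using cong_solve_coprime_int by blast
  have "[c + 2 * a * (- c * s) = 0] (mod int p)"
  proof -
    have "[c - c * (2 * a * s) = c - c * 1] (mod int p)"
      using s by (intro cong_diff cong_mult cong_refl)
    then show ?thesis by (simp add: algebra_simps)
  qed
  then obtain e where e: "c + 2 * a * (- c * s) = int p * e" by (auto simp: cong_0_iff)
  have "(a + P * (- c * s))^2 - k = (a^2 - k) + P * (2 * a * (- c * s)) + P * P * (c * s)^2"
    by (simp add: algebra_simps power2_eq_square)
  also have "\<dots> = P * (c + 2 * a * (- c * s)) + P * P * (c * s)^2"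
    by (simp add: c algebra_simps)
  also have "\<dots> = P * int p * (e + d * (c * s)^2)"
    by (simp only: e) (simp add: d algebra_simps)
  finally have "P * int p dvd (a + P * (- c * s))^2 - k" by simp
  moreover have "[a + P * (- c * s) = a] (mod P)" by (simp add: cong_iff_dvd_diff)
  ultimately show ?thesis by blast
qed

text \<open>Hensel lifting: every approximate root is prime to \<open>p\<close> because
  \<open>k\<close> is, so \<open>square_root_lift\<close> can be iterated.\<close>

lemma padic_square_root_exists:
  fixes k :: int
  assumes p: "prime p" "2 < p" and n: "\<not> int p dvd k" "int p dvd n^2 - k"
  obtains r where "r \<in> padic_ints p" "\<And>j. [r j * r j = k] (mod int p ^ j)"
proof -
  have nd: "\<not> int p dvd a" if "int p dvd a^2 - k" for a
  proof
    assume "int p dvd a"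
    then have "int p dvd a^2" by (simp add: power2_eq_square)
    then have "int p dvd a^2 - (a^2 - k)" using that by (rule dvd_diff)
    then show False using n by simp
  qed
  \<comment> \<open>The index is shifted so that the sequence can start from the root
    \<open>n\<close> modulo \<open>p\<close>; below, \<open>r j\<close> keeps \<open>f j\<close>
    only modulo \<open>p^j\<close>.\<close>
  have "\<exists>f. \<forall>j. int p ^ Suc j dvd (f j)^2 - k \<and> [f (Suc j) = f j] (mod int p ^ Suc j)"
  proof (rule dependent_nat_choice)
    show "\<exists>a. int p ^ Suc 0 dvd a^2 - k" using n by auto
  next
    fix a j
    assume a: "int p ^ Suc j dvd a^2 - k"
    then have "\<not> int p dvd a" by (intro nd) (auto elim: dvd_mult_left)
    from square_root_lift[OF p this a]
    show "\<exists>b. int p ^ Suc (Suc j) dvd b^2 - k \<and> [b = a] (mod int p ^ Suc j)"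
      by (auto simp: mult.commute)
  qed
  then obtain f where f: "\<And>j. int p ^ Suc j dvd (f j)^2 - k"
    and step: "\<And>j. [f (Suc j) = f j] (mod int p ^ Suc j)" by blast
  define r where "r = (\<lambda>j. f j mod int p ^ j)"
  have ppos: "int p ^ j > 0" for j using p by simp
  show thesis
  proof
    have "r (Suc j) mod int p ^ j = r j" for j
    proof -
      have "[f (Suc j) = f j] (mod int p ^ j)"
        by (rule cong_dvd_modulus[OF step[of j]]) simp
      then show ?thesis by (simp add: r_def cong_def mod_mod_cancel)
    qed
    then show "r \<in> padic_ints p"
      using ppos by (simp add: padic_ints_def r_def)
  next
    fix j
    have "int p ^ j dvd (f j)^2 - k" using f[of j] by (auto elim: dvd_mult_right)
    then show "[r j * r j = k] (mod int p ^ j)"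
      by (simp add: r_def cong_iff_dvd_diff[symmetric] cong_def power2_eq_square mod_simps)
  qed
qed

section \<open>Local points and the topology\<close>

lemma Um_Zp_iff:
  "(x, y, z) \<in> Um_Zp m p \<longleftrightarrow> x \<in> padic_ints p \<and> y \<in> padic_ints p \<and> z \<in> padic_ints p \<and>
     (\<forall>n. [x n * x n + y n * y n + z n * z n - x n * y n * z n = m] (mod int p ^ n))"
  by (simp add: Um_Zp_def markoff_padic_def padic_sub_def padic_add_def padic_mult_def
      padic_of_int_def fun_eq_iff cong_def mod_simps)

lemma zero_in_padic_ints: "0 < p \<Longrightarrow> (\<lambda>n. 0) \<in> padic_ints p"
  by (simp add: padic_ints_def)

lemma padic_of_int_in_padic_ints: "0 < p \<Longrightarrow> padic_of_int p k \<in> padic_ints p"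
  by (simp add: padic_ints_def padic_of_int_def mod_mod_cancel)

lemma padic_mult_in_padic_ints:
  assumes "0 < p" "x \<in> padic_ints p" "y \<in> padic_ints p"
  shows "padic_mult p x y \<in> padic_ints p"
proof -
  have "(x (Suc n) * y (Suc n)) mod int p ^ n = (x n * y n) mod int p ^ n" for n
  proof -
    have "x n = x (Suc n) mod int p ^ n" "y n = y (Suc n) mod int p ^ n"
      using assms by (simp_all add: padic_ints_def)
    then show ?thesis by (simp only: mod_mult_eq)
  qed
  then show ?thesis using assms(1)
    by (simp add: padic_ints_def padic_mult_def mod_mod_cancel)
qed

lemma topspace_padic_topology: "topspace (padic_topology p) = padic_ints p"
  by (auto simp: padic_topology_def topology_generated_by_topspace)

lemma openin_padic_ball:
  "x \<in> padic_ints p \<Longrightarrow> openin (padic_topology p) {y \<in> padic_ints p. y n = x n}"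
  unfolding padic_topology_def by (rule topology_generated_by_Basis) auto

lemma topspace_Um_Zp_topology: "topspace (Um_Zp_topology m p) = Um_Zp m p"
  by (auto simp: Um_Zp_topology_def topspace_padic_topology Um_Zp_def)

lemma openin_Um_Zp_ball:
  assumes "(a, b, c) \<in> Um_Zp m p"
  shows "openin (Um_Zp_topology m p) {(x, y, z) \<in> Um_Zp m p. x n = a n \<and> y n = b n \<and> z n = c n}"
proof -
  let ?B = "\<lambda>a. {y \<in> padic_ints p. y n = a n}"
  have "openin (prod_topology (padic_topology p) (prod_topology (padic_topology p) (padic_topology p)))
     (?B a \<times> ?B b \<times> ?B c)"
    using assms by (auto simp: openin_prod_Times_iff Um_Zp_def intro!: openin_padic_ball)
  then have "openin (Um_Zp_topology m p) (Um_Zp m p \<inter> (?B a \<times> ?B b \<times> ?B c))"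
    unfolding Um_Zp_topology_def by (rule openin_subtopology_Int2)
  moreover have "Um_Zp m p \<inter> (?B a \<times> ?B b \<times> ?B c)
      = {(x, y, z) \<in> Um_Zp m p. x n = a n \<and> y n = b n \<and> z n = c n}"
    by (auto simp: Um_Zp_def)
  ultimately show ?thesis by simp
qed

text \<open>Conditions at two indices cut out an open set of the product, so a dense diagonal image
  must meet it once it is nonempty.\<close>

lemma dense_approximates_at_two_primes:
  assumes dense: "product_topology (Um_Zp_topology m) I closure_of (diag_map I ` Um_Z m)
      = topspace (product_topology (Um_Zp_topology m) I)"
    and nonempty: "\<forall>i\<in>I. Um_Zp m i \<noteq> {}"
    and I: "p \<in> I" "q \<in> I" "p \<noteq> q"
    and P: "(a, b, c) \<in> Um_Zp m p" and Q: "(a', b', c') \<in> Um_Zp m q"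
  obtains x y z where "x^2 + y^2 + z^2 - x*y*z = m"
    "x mod int p ^ n = a n" "y mod int p ^ n = b n" "z mod int p ^ n = c n"
    "x mod int q ^ n = a' n" "y mod int q ^ n = b' n" "z mod int q ^ n = c' n"
proof -
  let ?X = "product_topology (Um_Zp_topology m) I"
  let ?B = "{(x, y, z) \<in> Um_Zp m p. x n = a n \<and> y n = b n \<and> z n = c n}"
  let ?C = "{(x, y, z) \<in> Um_Zp m q. x n = a' n \<and> y n = b' n \<and> z n = c' n}"
  \<comment> \<open>At the other primes any local point serves; one exists by
    \<open>nonempty\<close>.\<close>
  define f where "f = restrict (\<lambda>i. if i = p then (a, b, c) else if i = q then (a', b', c')
    else SOME u. u \<in> Um_Zp m i) I"
  have f: "f \<in> topspace ?X"
    using P Q nonempty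
    by (auto simp: f_def topspace_Um_Zp_topology some_in_eq)
  define T where "T = {g \<in> topspace ?X. g p \<in> ?B} \<inter> {g \<in> topspace ?X. g q \<in> ?C}"
  have "openin ?X T"
    unfolding T_def using I P Q
    by (intro openin_Int openin_continuous_map_preimage[OF continuous_map_product_projection]
        openin_Um_Zp_ball)
  moreover have "f \<in> T"
    using f I P Q by (simp add: T_def f_def)
  moreover have "f \<in> ?X closure_of (diag_map I ` Um_Z m)"
    using f dense by simp
  ultimately obtain g where g: "g \<in> diag_map I ` Um_Z m" "g \<in> T"
    unfolding in_closure_of by blast
  then obtain x y z where "(x, y, z) \<in> Um_Z m" "g = diag_map I (x, y, z)" by auto
  with g(2) I show thesis
    by (intro that[of x y z]) (auto simp: T_def diag_map_def Um_Z_def padic_of_int_def)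
qed

section \<open>Failure of density away from \<open>S\<close>\<close>

theorem theorem6p2:
  fixes m :: int and S :: "nat set"
  assumes "Um_R m \<noteq> {}"
    and "\<forall>p. prime p \<longrightarrow> Um_Zp m p \<noteq> {}"
    and "finite S" and "\<forall>p\<in>S. prime p"
  shows "product_topology (Um_Zp_topology m) {p. prime p \<and> p \<notin> S}
           closure_of (diag_map {p. prime p \<and> p \<notin> S} ` Um_Z m)
         \<noteq> topspace (product_topology (Um_Zp_topology m) {p. prime p \<and> p \<notin> S})"
proof
  let ?I = "{p. prime p \<and> p \<notin> S}"
  assume dense: "product_topology (Um_Zp_topology m) ?I closure_of (diag_map ?I ` Um_Z m)
         = topspace (product_topology (Um_Zp_topology m) ?I)"
  have nonempty: "\<forall>i\<in>?I. Um_Zp m i \<noteq> {}" using assms(2) by simp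
  \<comment> \<open>The number whose square root is needed: \<open>m\<close> itself, or
    \<open>-1\<close> when \<open>m = 0\<close>.\<close>
  define k where "k = (if m = 0 then -1 else m)"
  have "k \<noteq> 0" by (simp add: k_def)
  obtain N where N: "\<And>i. i \<in> S \<Longrightarrow> i \<le> N"
    using \<open>finite S\<close> by (auto simp: finite_nat_set_iff_bounded_le)
  \<comment> \<open>The bound \<open>M\<close> lets the second prime be chosen beyond the
    first.\<close>
  have root: "\<exists>p r. M < p \<and> p \<in> ?I \<and> nat \<bar>m\<bar> + 4 < p \<and> r \<in> padic_ints p \<and>
      (\<forall>j. [r j * r j = k] (mod int p ^ j))" for M
  proof -
    \<comment> \<open>A prime beyond this bound exceeds \<open>M\<close>, avoids \<open>S\<close>,
      is odd and does not divide \<open>k\<close>.\<close>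
    obtain p n where p: "prime p" "M + N + nat \<bar>m\<bar> + 4 < p" "int p dvd n^2 - k"
      by (rule ex_large_prime_dvd_square_diff[OF \<open>k \<noteq> 0\<close>])
    have "2 < p" using p(2) by simp
    have "\<not> int p dvd k"
      using dvd_imp_le_int[OF \<open>k \<noteq> 0\<close>, of "int p"] p(2) by (auto simp: k_def split: if_splits)
    then obtain r where "r \<in> padic_ints p" "\<And>j. [r j * r j = k] (mod int p ^ j)"
      using padic_square_root_exists[OF p(1) \<open>2 < p\<close> _ p(3)] by blast
    moreover have "p \<notin> S" using N[of p] p(2) by auto
    ultimately show ?thesis
      using p by (intro exI[of _ p] exI[of _ r]) auto
  qed
  obtain p r where p: "p \<in> ?I" "nat \<bar>m\<bar> + 4 < p" "r \<in> padic_ints p"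
    "\<And>j. [r j * r j = k] (mod int p ^ j)" using root[of 0] by blast
  obtain q s where q: "p < q" "q \<in> ?I" "nat \<bar>m\<bar> + 4 < q" "s \<in> padic_ints q"
    "\<And>j. [s j * s j = k] (mod int q ^ j)" using root[of p] by blast
  show False
  proof (cases "m = 0")
    case False
    have "(r, \<lambda>n. 0, \<lambda>n. 0) \<in> Um_Zp m p" "(\<lambda>n. 0, s, \<lambda>n. 0) \<in> Um_Zp m q"
      using False p q by (auto simp: Um_Zp_iff k_def zero_in_padic_ints)
    \<comment> \<open>Level 1 suffices: only divisibility by \<open>p\<close> and \<open>q\<close>
      is to be read off.\<close>
    with less_imp_neq[OF q(1)] obtain x y z where "x^2 + y^2 + z^2 - x*y*z = m"
      "y mod int p ^ 1 = 0" "z mod int p ^ 1 = 0" "x mod int q ^ 1 = 0" "z mod int q ^ 1 = 0"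
      by (rule dense_approximates_at_two_primes[OF dense nonempty p(1) q(2), where n = 1])
    then show False
      using no_integral_point_near_axes[OF False p(2) q(3), of x y z] by (simp add: mod_eq_0_iff_dvd)
  next
    case True
    let ?y = "padic_of_int p (int p)"
    \<comment> \<open>The point \<open>(0, p, p*r)\<close> satisfies the equation because
      \<open>p^2 + p^2*r^2 = 0\<close> when \<open>r^2 = -1\<close>.\<close>
    have "(\<lambda>n. 0, ?y, padic_mult p ?y r) \<in> Um_Zp m p"
    proof -
      have "[?y n * ?y n + padic_mult p ?y r n * padic_mult p ?y r n = 0] (mod int p ^ n)" for n
      proof -
        have "[int p * int p + int p * int p * (r n * r n) = int p * int p + int p * int p * (- 1)]
            (mod int p ^ n)"
          using p(4)[of n] True by (intro cong_add cong_mult cong_refl) (simp add: k_def)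
        then have "[int p * int p + (int p * r n) * (int p * r n) = 0] (mod int p ^ n)"
          by (simp add: algebra_simps)
        moreover have "[?y n = int p] (mod int p ^ n)"
          "[padic_mult p ?y r n = int p * r n] (mod int p ^ n)"
          by (simp_all add: padic_of_int_def padic_mult_def cong_def mod_simps)
        ultimately show ?thesis
          by (blast intro: cong_trans cong_add cong_mult)
      qed
      then show ?thesis
        using p True by (simp add: Um_Zp_iff zero_in_padic_ints padic_of_int_in_padic_ints
            padic_mult_in_padic_ints)
    qed
    moreover obtain a b c where "(a, b, c) \<in> Um_Zp m q"
      using bspec[OF nonempty q(2)] by auto
    \<comment> \<open>Level 2 is essential: modulo \<open>p\<close> the chosen point looks like the
      origin, while modulo \<open>p^2\<close> its second coordinate \<open>p\<close> is
      nonzero.\<close>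
    ultimately
    obtain x y z where eq: "x^2 + y^2 + z^2 - x*y*z = m"
      and xyz: "x mod int p ^ 2 = 0" "y mod int p ^ 2 = ?y 2" "z mod int p ^ 2 = padic_mult p ?y r 2"
      by (rule dense_approximates_at_two_primes
          [OF dense nonempty p(1) q(2) less_imp_neq[OF q(1)], where n = 2])
    have "int p dvd t" if "t mod int p ^ 2 = (int p * u) mod int p ^ 2" for t u
    proof -
      have "[t = int p * u] (mod int p)"
        by (rule cong_dvd_modulus[of _ _ "int p ^ 2"]) (use that in \<open>auto simp: cong_def\<close>)
      then show ?thesis by (simp add: cong_def mod_eq_0_iff_dvd)
    qed
    from this[of x 0] this[of y 1] this[of z "r 2"]
    have "int p dvd x" "int p dvd y" "int p dvd z"
      using xyz by (auto simp: padic_of_int_def padic_mult_def mod_simps)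
    then have "y = 0"
      using markoff_point_divisible_imp_zero[of p x y z] eq True p(2) by simp
    then have "int p ^ 2 dvd int p"
      using xyz(2) by (simp add: padic_of_int_def mod_eq_0_iff_dvd)
    then show False
      using p(2) zdvd_imp_le[of "int p ^ 2" "int p"] by (simp add: power2_eq_square)
  qed
qed

end
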